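(* Let $A$ be a commutative short local algebra. Then any complex of type I involving a projective module of rank $1$ is periodic of period $2$, and there is no complex of type II involving a projective module of rank $1$.
   Context: Let $k$ be a field. All algebras $A$ are finite-dimensional local $k$-algebras with radical $J$ such that $A/J=k$. $A$ is short if $J^3=0$. Modules are $A$-modules of finite length. An exact complex of projective modules is a $\mathbb Z$-indexed sequence $P_\bullet=(P_i,d_i\colon P_i\to P_{i-1})_{i\in\mathbb Z}$ with $P_i$ projective (hence free) and $\operatorname{Im}d_i=\operatorname{Ker}d_{i-1}$ for all $i$. It is minimal if each $d_i$ maps into $JP_{i-1}$. Let $t_i$ be the rank of $P_i$. A complex of type I is a non-zero minimal exact complex of projective modules in which all $P_i$ have the same rank. A complex of type II is a non-zero minimal exact complex of projective modules such that for some integer $v$ one has $\cdots>t_{v+2}>t_{v+1}>t_v=t_{v-1}=t_{v-2}=\cdots$. "Periodic of period $2$" means that $P_\bullet$ is isomorphic, as a sequence of modules and maps, to its translate by two places $(P_{i+2},d_{i+2})_{i\in\mathbb Z}$ (the minimal period may be $1$). *)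

theory Defs
  imports
    "HOL-Algebra.Algebra"
    "Jordan_Normal_Form.Missing_VectorSpace"
begin

text \<open>
  The locale \<^locale>\<open>algebra\<close> describes commutative associative unital algebras. An algebra
  \<open>A\<close> over \<open>k\<close> is at the same time a ring (the scalars of its modules) and a vector space
  over \<open>k\<close>.
\<close>

subsection \<open>Short local algebras\<close>

definition is_local_ring :: "('a, 'm) ring_scheme \<Rightarrow> bool" where
  "is_local_ring A \<longleftrightarrow> (\<exists>!I. maximalideal I A)"

definition jacobson_radical :: "('a, 'm) ring_scheme \<Rightarrow> 'a set" where
  "jacobson_radical A = carrier A \<inter> \<Inter> {I. maximalideal I A}"

text \<open>
  In the last condition below, the structure map \<open>c \<mapsto> c\<cdot>1 + J\<close> from \<open>k\<close> to \<open>A/J\<close> is always a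
  homomorphism of \<open>k\<close>-algebras, so its bijectivity says that \<open>A/J = k\<close>.
\<close>

definition fd_local_algebra :: "('k, 'm) ring_scheme \<Rightarrow> ('k, 'a, 'n) module_scheme \<Rightarrow> bool" where
  "fd_local_algebra k A \<longleftrightarrow>
     field k \<and> algebra k A \<and> vectorspace.fin_dim k A \<and> is_local_ring A \<and>
     bij_betw (\<lambda>c. jacobson_radical A +>\<^bsub>A\<^esub> (c \<odot>\<^bsub>A\<^esub> \<one>\<^bsub>A\<^esub>))
       (carrier k) (carrier (A Quot jacobson_radical A))"

definition short :: "('a, 'm) ring_scheme \<Rightarrow> bool" where
  "short A \<longleftrightarrow>
     ideal_prod A (ideal_prod A (jacobson_radical A) (jacobson_radical A)) (jacobson_radical A)
       = {\<zero>\<^bsub>A\<^esub>}"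

subsection \<open>Projective modules and rank\<close>

text \<open>
  A projective module of finite length is a direct summand of a free module of finite rank;
  \<open>ring.func_space A {..<n}\<close> is \<open>A\<^sup>n\<close>. Conversely, over a finite-dimensional algebra such a
  summand has finite length.
\<close>

definition projective_module :: "('a, 'm) ring_scheme \<Rightarrow> ('a, 'p, 'n) module_scheme \<Rightarrow> bool" where
  "projective_module A P \<longleftrightarrow>
     module A P \<and>
     (\<exists>(n::nat) \<iota> \<pi>.
        \<iota> \<in> module_hom A P (ring.func_space A {..<n}) \<and>
        \<pi> \<in> module_hom A (ring.func_space A {..<n}) P \<and>
        (\<forall>x\<in>carrier P. \<pi> (\<iota> x) = x))"

definition finite_basis ::
  "('a, 'm) ring_scheme \<Rightarrow> ('a, 'p, 'n) module_scheme \<Rightarrow> 'p set \<Rightarrow> bool" where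
  "finite_basis A P B \<longleftrightarrow>
     finite B \<and> B \<subseteq> carrier P \<and> module.span A P B = carrier P \<and> \<not> module.lin_dep A P B"

text \<open>
  Over a nonzero commutative ring all finite bases of a module have the same cardinality, so the
  least cardinality is the cardinality of any finite basis. The value is meaningful for free
  modules of finite rank only; over a local algebra these are exactly the projective modules
  of finite length.
\<close>

definition module_rank :: "('a, 'm) ring_scheme \<Rightarrow> ('a, 'p, 'n) module_scheme \<Rightarrow> nat" where
  "module_rank A P = (LEAST n. \<exists>B. finite_basis A P B \<and> card B = n)"

text \<open>The submodule \<open>JP\<close>.\<close>

definition radical_submodule ::
  "('a, 'm) ring_scheme \<Rightarrow> ('a, 'p, 'n) module_scheme \<Rightarrow> 'p set" where
  "radical_submodule A P =
     module.span A P {a \<odot>\<^bsub>P\<^esub> x | a x. a \<in> jacobson_radical A \<and> x \<in> carrier P}"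

subsection \<open>Complexes\<close>

text \<open>
  A complex is given by modules \<open>P i\<close> and maps \<open>d i\<close> from \<open>P i\<close> to \<open>P (i - 1)\<close>. All modules have
  carriers in one type \<open>'p\<close>, which is arbitrary.
\<close>

definition exact_projective_complex ::
  "('a, 'm) ring_scheme \<Rightarrow> (int \<Rightarrow> ('a, 'p, 'n) module_scheme) \<Rightarrow> (int \<Rightarrow> 'p \<Rightarrow> 'p) \<Rightarrow> bool" where
  "exact_projective_complex A P d \<longleftrightarrow>
     (\<forall>i. projective_module A (P i)) \<and>
     (\<forall>i. d i \<in> module_hom A (P i) (P (i - 1))) \<and>
     (\<forall>i. mod_hom.im (P i) (d i) = mod_hom.ker (P (i - 1)) (P (i - 2)) (d (i - 1)))"

definition minimal_complex ::
  "('a, 'm) ring_scheme \<Rightarrow> (int \<Rightarrow> ('a, 'p, 'n) module_scheme) \<Rightarrow> (int \<Rightarrow> 'p \<Rightarrow> 'p) \<Rightarrow> bool" where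
  "minimal_complex A P d \<longleftrightarrow>
     (\<forall>i. mod_hom.im (P i) (d i) \<subseteq> radical_submodule A (P (i - 1)))"

definition nonzero_complex :: "(int \<Rightarrow> ('a, 'p, 'n) module_scheme) \<Rightarrow> bool" where
  "nonzero_complex P \<longleftrightarrow> (\<exists>i. carrier (P i) \<noteq> {\<zero>\<^bsub>P i\<^esub>})"

definition complex_type_I ::
  "('a, 'm) ring_scheme \<Rightarrow> (int \<Rightarrow> ('a, 'p, 'n) module_scheme) \<Rightarrow> (int \<Rightarrow> 'p \<Rightarrow> 'p) \<Rightarrow> bool" where
  "complex_type_I A P d \<longleftrightarrow>
     exact_projective_complex A P d \<and> minimal_complex A P d \<and> nonzero_complex P \<and>
     (\<forall>i j. module_rank A (P i) = module_rank A (P j))"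

definition complex_type_II ::
  "('a, 'm) ring_scheme \<Rightarrow> (int \<Rightarrow> ('a, 'p, 'n) module_scheme) \<Rightarrow> (int \<Rightarrow> 'p \<Rightarrow> 'p) \<Rightarrow> bool" where
  "complex_type_II A P d \<longleftrightarrow>
     exact_projective_complex A P d \<and> minimal_complex A P d \<and> nonzero_complex P \<and>
     (\<exists>v. (\<forall>i\<ge>v. module_rank A (P (i + 1)) > module_rank A (P i)) \<and>
          (\<forall>i\<le>v. module_rank A (P i) = module_rank A (P v)))"

definition periodic_2 ::
  "('a, 'm) ring_scheme \<Rightarrow> (int \<Rightarrow> ('a, 'p, 'n) module_scheme) \<Rightarrow> (int \<Rightarrow> 'p \<Rightarrow> 'p) \<Rightarrow> bool" where
  "periodic_2 A P d \<longleftrightarrow>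
     (\<exists>\<phi>. \<forall>i. \<phi> i \<in> module_hom A (P i) (P (i + 2)) \<and>
              bij_betw (\<phi> i) (carrier (P i)) (carrier (P (i + 2))) \<and>
              (\<forall>x\<in>carrier (P i). \<phi> (i - 1) (d i x) = d (i + 2) (\<phi> i x)))"

end

theory Submission
  imports Defs
begin

text \<open>
  Let \<open>J\<close> be the radical. In a rank-one stretch of the complex, choosing a generator \<open>e i\<close> of each
  \<open>P i\<close> turns \<open>d i\<close> into multiplication by an element \<open>w i\<close>, and exactness says
  \<open>ann (w i) = (w (i + 1))\<close>. Taking annihilators is an order-reversing Galois connection on ideals, so
  \<open>ann (ann (ann I)) = ann I\<close>; this turns two consecutive exactness conditions into
  \<open>ann (w (i + 2)) = (w (i + 1))\<close> (lemma \<open>annihilator_two_step\<close>). Both parts of the theorem follow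
  from that identity.

  In a complex of type I every term has rank one, so \<open>(w (i + 1)) = ann (w (i + 2)) = (w (i + 3))\<close>
  for all \<open>i\<close>. Over a local ring two generators of the same principal ideal differ by a unit, say
  \<open>w (i + 2) = u i * w i\<close>. Sending \<open>e i\<close> to \<open>c i * e (i + 2)\<close> commutes with the differentials as
  soon as the units \<open>c i\<close> satisfy \<open>c (i - 1) = c i * u i\<close>, a recursion that can be solved in both
  directions starting from \<open>c 0 = 1\<close>.

  In a complex of type II the constant value of the ranks is the smallest rank, so it is \<open>0\<close> or
  \<open>1\<close>. If it is \<open>1\<close>, the identity at the last index \<open>v\<close> of the constant range shows that
  \<open>ker (d v) = (w (v - 1)) e v\<close> is cyclic; if it is \<open>0\<close>, then \<open>ker (d v) = 0\<close>. By exactness this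
  kernel is the image of \<open>P (v + 1)\<close>, and by minimality the kernel of \<open>P (v + 1) \<rightarrow> P v\<close> lies in
  \<open>J P (v + 1)\<close>. Nakayama's lemma then gives \<open>P (v + 1)\<close> at most as many generators as the image
  needs, which contradicts the growth of the rank.

  The rank is the least size of a basis, so all this presupposes that the projective modules in
  question have bases, and that the rank is bounded by the size of any generating set. Both come from
  \<open>minimal_generators_basis\<close>: over a short local ring, an irredundant finite generating set of a
  projective module is a basis.
\<close>

section \<open>Short local rings\<close>

text \<open>
  A short local algebra regarded as a ring. The scalars enter only through the fact that every
  element outside the radical is invertible.
\<close>

locale short_local_ring = cring R for R (structure) +
  assumes radical_ideal: "ideal (jacobson_radical R) R"
    and unit_or_radical: "a \<in> carrier R \<Longrightarrow> a \<in> jacobson_radical R \<or> a \<in> Units R"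
    and radical_cubed: "\<lbrakk>x \<in> jacobson_radical R; y \<in> jacobson_radical R; z \<in> jacobson_radical R\<rbrakk>
      \<Longrightarrow> x \<otimes> y \<otimes> z = \<zero>"

lemma (in cring) one_plus_nilpotent_unit:
  assumes j: "j \<in> carrier R" and cube: "j \<otimes> j \<otimes> j = \<zero>"
  shows "\<one> \<oplus> j \<in> Units R"
proof -
  let ?q = "\<one> \<ominus> j \<oplus> j \<otimes> j"
  have "(\<one> \<oplus> j) \<otimes> ?q = \<one> \<oplus> j \<otimes> j \<otimes> j"
    using j by algebra
  then have "(\<one> \<oplus> j) \<otimes> ?q = \<one>"
    using cube by simp
  moreover have "?q \<in> carrier R" "\<one> \<oplus> j \<in> carrier R"
    using j by auto
  ultimately show ?thesis
    using m_comm unfolding Units_def by fastforce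
qed

text \<open>
  Since \<open>A/J = k\<close>, every element is \<open>c + j\<close> with a scalar \<open>c\<close> and \<open>j \<in> J\<close>. Outside \<open>J\<close> the
  scalar is nonzero, and after division by it the element becomes \<open>1\<close> plus a nilpotent one.
\<close>

lemma fd_short_local_ring:
  assumes "fd_local_algebra k A" and "short A"
  shows "short_local_ring A"
proof -
  let ?J = "jacobson_radical A"
  have "field k" and "algebra k A" and loc: "is_local_ring A"
    and bij: "bij_betw (\<lambda>c. ?J +>\<^bsub>A\<^esub> (c \<odot>\<^bsub>A\<^esub> \<one>\<^bsub>A\<^esub>)) (carrier k) (carrier (A Quot ?J))"
    using assms(1) unfolding fd_local_algebra_def by auto
  interpret k: field k by fact
  interpret A: algebra k A by fact
  obtain I where I: "maximalideal I A" and uniq: "\<And>I'. maximalideal I' A \<Longrightarrow> I' = I"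
    using loc unfolding is_local_ring_def by auto
  interpret I: maximalideal I A by fact
  have JI: "?J = I"
  proof -
    have "{I'. maximalideal I' A} = {I}"
      using I uniq by blast
    then show ?thesis
      using I.a_subset unfolding jacobson_radical_def by auto
  qed
  have cube: "x \<otimes>\<^bsub>A\<^esub> y \<otimes>\<^bsub>A\<^esub> z = \<zero>\<^bsub>A\<^esub>" if "x \<in> I" "y \<in> I" "z \<in> I" for x y z
  proof -
    have "x \<otimes>\<^bsub>A\<^esub> y \<otimes>\<^bsub>A\<^esub> z \<in> ideal_prod A (ideal_prod A I I) I"
      using that by (intro ideal_prod.prod)
    then show ?thesis
      using assms(2) unfolding short_def JI by simp
  qed
  have unit: "a \<in> Units A" if a: "a \<in> carrier A" "a \<notin> I" for a
  proof -
    have "I +>\<^bsub>A\<^esub> a \<in> carrier (A Quot I)"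
      using a I.a_subset by (simp add: FactRing_def A.a_rcosetsI)
    then obtain c where c: "c \<in> carrier k" and eq: "I +>\<^bsub>A\<^esub> a = I +>\<^bsub>A\<^esub> (c \<odot>\<^bsub>A\<^esub> \<one>\<^bsub>A\<^esub>)"
      using bij unfolding JI bij_betw_def by (metis (no_types, lifting) imageE)
    have c1: "c \<odot>\<^bsub>A\<^esub> \<one>\<^bsub>A\<^esub> \<in> carrier A"
      using c by simp
    have diff: "a \<ominus>\<^bsub>A\<^esub> (c \<odot>\<^bsub>A\<^esub> \<one>\<^bsub>A\<^esub>) \<in> I"
      using A.quotient_eq_iff_same_a_r_cos[OF I.is_ideal a(1) c1] eq by simp
    have "c \<noteq> \<zero>\<^bsub>k\<^esub>"
    proof
      assume "c = \<zero>\<^bsub>k\<^esub>"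
      then have "a \<in> I" using diff a by (simp add: A.minus_eq)
      then show False using a by simp
    qed
    then have cu: "c \<in> Units k" using c k.field_Units by auto
    let ?u = "inv\<^bsub>k\<^esub> c \<odot>\<^bsub>A\<^esub> \<one>\<^bsub>A\<^esub>" and ?c = "c \<odot>\<^bsub>A\<^esub> \<one>\<^bsub>A\<^esub>"
    have u: "?u \<in> carrier A"
      using cu by simp
    have "?u \<otimes>\<^bsub>A\<^esub> ?c = inv\<^bsub>k\<^esub> c \<odot>\<^bsub>A\<^esub> ?c"
      using cu c1 by (simp add: A.smult_assoc2)
    also have "\<dots> = (inv\<^bsub>k\<^esub> c \<otimes>\<^bsub>k\<^esub> c) \<odot>\<^bsub>A\<^esub> \<one>\<^bsub>A\<^esub>"
      using cu c by (intro A.smult_assoc1[symmetric]) auto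
    finally have uc: "?u \<otimes>\<^bsub>A\<^esub> ?c = \<one>\<^bsub>A\<^esub>"
      using cu by simp
    let ?j = "?u \<otimes>\<^bsub>A\<^esub> (a \<ominus>\<^bsub>A\<^esub> ?c)"
    have j: "?j \<in> I"
      using diff u by (rule I.I_l_closed)
    have "?u \<otimes>\<^bsub>A\<^esub> a = ?u \<otimes>\<^bsub>A\<^esub> ?c \<oplus>\<^bsub>A\<^esub> ?j"
      using u a c1 by algebra
    moreover have "\<one>\<^bsub>A\<^esub> \<oplus>\<^bsub>A\<^esub> ?j \<in> Units A"
      by (rule A.one_plus_nilpotent_unit[OF I.Icarr[OF j] cube[OF j j j]])
    ultimately have "?u \<otimes>\<^bsub>A\<^esub> a \<in> Units A"
      using uc by simp
    then have "a \<otimes>\<^bsub>A\<^esub> ?u \<in> Units A"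
      using A.m_comm[OF u a(1)] by simp
    then show ?thesis
      using a(1) u by (rule A.unit_factor)
  qed
  show ?thesis
  proof (intro short_local_ring.intro short_local_ring_axioms.intro)
    show "cring A" by (rule A.M_cring)
  qed (use I.is_ideal cube unit JI in blast)+
qed

definition annihilator :: "('a, 'm) ring_scheme \<Rightarrow> 'a \<Rightarrow> 'a set" where
  "annihilator R w = {a \<in> carrier R. a \<otimes>\<^bsub>R\<^esub> w = \<zero>\<^bsub>R\<^esub>}"

text \<open>
  Commutativity makes \<open>w1 w0 = 0\<close> say that \<open>w0\<close> annihilates \<open>w1\<close>, so \<open>w0\<close> is a multiple of
  \<open>w2\<close>. Hence whatever annihilates \<open>w2\<close> annihilates \<open>w0\<close>, and is a multiple of \<open>w1\<close>.
\<close>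

lemma (in cring) annihilator_two_step:
  assumes w: "w0 \<in> carrier R" "w1 \<in> carrier R" "w2 \<in> carrier R"
    and ann0: "annihilator R w0 = PIdl w1" and ann1: "annihilator R w1 = PIdl w2"
  shows "annihilator R w2 = PIdl w1"
proof
  have "w1 \<in> annihilator R w0" "w2 \<in> annihilator R w1"
    using ann0 ann1 w cgenideal_self by auto
  then have z: "w1 \<otimes> w0 = \<zero>" "w2 \<otimes> w1 = \<zero>"
    by (auto simp: annihilator_def)
  have "w0 \<in> annihilator R w1"
    using z(1) w by (simp add: annihilator_def m_comm)
  then obtain b where b: "b \<in> carrier R" "w0 = b \<otimes> w2"
    using ann1 by (auto simp: cgenideal_def)
  show "annihilator R w2 \<subseteq> PIdl w1"
  proof
    fix a assume "a \<in> annihilator R w2"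
    then have a: "a \<in> carrier R" "a \<otimes> w2 = \<zero>"
      by (auto simp: annihilator_def)
    have "a \<otimes> w0 = b \<otimes> (a \<otimes> w2)"
      unfolding b(2) using a(1) b(1) w(3) by (rule m_lcomm)
    then have "a \<in> annihilator R w0"
      using a b by (simp add: annihilator_def)
    then show "a \<in> PIdl w1" using ann0 by simp
  qed
  show "PIdl w1 \<subseteq> annihilator R w2"
  proof
    fix x assume "x \<in> PIdl w1"
    then obtain a where a: "a \<in> carrier R" "x = a \<otimes> w1"
      by (auto simp: cgenideal_def)
    have "x \<otimes> w2 = a \<otimes> (w2 \<otimes> w1)"
      using a w by (simp add: m_assoc m_comm[of w1 w2])
    then show "x \<in> annihilator R w2"
      using a w z by (simp add: annihilator_def)
  qed
qed

text \<open>
  Zero divisors are possible, so mutual divisibility alone would not produce a unit; locality does.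
\<close>

lemma (in short_local_ring) same_ideal_unit_multiple:
  assumes a: "a \<in> carrier R" and b: "b \<in> carrier R" and eq: "PIdl a = PIdl b"
  shows "\<exists>u\<in>Units R. b = u \<otimes> a"
proof (cases "a = \<zero>")
  case True
  have "b \<in> PIdl a" using eq b cgenideal_self by auto
  then have "b = \<one> \<otimes> a" using True by (auto simp: cgenideal_def)
  then show ?thesis by blast
next
  case False
  interpret J: ideal "jacobson_radical R" R by (rule radical_ideal)
  have "b \<in> PIdl a" "a \<in> PIdl b" using eq a b cgenideal_self by auto
  then obtain x y where x: "x \<in> carrier R" "b = x \<otimes> a" and y: "y \<in> carrier R" "a = y \<otimes> b"
    by (auto simp: cgenideal_def)
  have "x \<in> Units R"
  proof (rule ccontr)
    assume "x \<notin> Units R"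
    then have "x \<in> jacobson_radical R" using unit_or_radical x by auto
    \<comment> \<open>then \<open>a = (y x) a\<close> with \<open>y x\<close> in the radical, and iterating gives \<open>a = (y x)\<^sup>3 a = 0\<close>\<close>
    then have yx: "y \<otimes> x \<in> jacobson_radical R" using y J.I_l_closed by simp
    have *: "y \<otimes> x \<otimes> a = a" using x y a by (simp add: m_assoc)
    have "a = (y \<otimes> x) \<otimes> ((y \<otimes> x) \<otimes> ((y \<otimes> x) \<otimes> a))" by (simp only: *)
    also have "\<dots> = ((y \<otimes> x) \<otimes> (y \<otimes> x) \<otimes> (y \<otimes> x)) \<otimes> a"
      using x y a by (simp add: m_assoc)
    also have "\<dots> = \<zero>" using radical_cubed[OF yx yx yx] a by simp
    finally show False using False by simp
  qed
  then show ?thesis using x by blast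
qed


text \<open>
  The recursion can be run upwards because \<open>u i\<close> is invertible, and downwards as it stands.
\<close>

lemma (in cring) unit_thread:
  fixes u :: "int \<Rightarrow> 'a"
  assumes u: "\<And>i. u i \<in> Units R"
  shows "\<exists>c. \<forall>i. c i \<in> Units R \<and> c (i - 1) = c i \<otimes> u i"
proof -
  define f where "f = rec_nat \<one> (\<lambda>n x. x \<otimes> inv u (int (Suc n)))"
  define g where "g = rec_nat \<one> (\<lambda>n x. x \<otimes> u (- int n))"
  have f: "f 0 = \<one>" "f (Suc n) = f n \<otimes> inv u (int (Suc n))" for n
    by (simp_all add: f_def)
  have g: "g 0 = \<one>" "g (Suc n) = g n \<otimes> u (- int n)" for n
    by (simp_all add: g_def)
  have fU: "f n \<in> Units R" for n
    by (induction n) (simp_all add: f u)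
  have gU: "g n \<in> Units R" for n
    by (induction n) (simp_all add: g u)
  define c where "c i = (if i \<ge> 0 then f (nat i) else g (nat (- i)))" for i
  have "c (i - 1) = c i \<otimes> u i" for i
  proof (cases "i \<ge> 1")
    case True
    define n where "n = nat (i - 1)"
    have i: "i = int (Suc n)" using True by (simp add: n_def)
    have "c i = f n \<otimes> inv u i" "c (i - 1) = f n"
      using f(2)[of n] by (simp_all add: c_def i nat_add_distrib)
    then show ?thesis
      using fU[of n] u[of i] by (simp add: m_assoc Units_closed)
  next
    case False
    define n where "n = nat (- i)"
    have i: "i = - int n" using False by (simp add: n_def)
    have "c i = g n"
      by (cases "n = 0") (simp_all add: c_def i f g)
    moreover have "nat (1 + int n) = Suc n" by simp
    then have "c (i - 1) = g n \<otimes> u i"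
      using g(2)[of n] by (simp add: c_def i)
    ultimately show ?thesis by simp
  qed
  then show ?thesis
    using fU gU by (intro exI[of _ c]) (simp add: c_def)
qed

section \<open>Homomorphisms out of a free module\<close>

definition (in ring) unit_vector :: "nat \<Rightarrow> nat \<Rightarrow> nat \<Rightarrow> 'a" where
  "unit_vector n j = (\<lambda>i\<in>{..<n}. if i = j then \<one> else \<zero>)"

lemma (in cring) unit_vector_closed: "unit_vector n j \<in> carrier (func_space {..<n})"
  by (auto simp: unit_vector_def func_space_def)

text \<open>
  A vector is built up from zero by switching on one coordinate at a time. The induction avoids
  evaluating finite sums in the function module.
\<close>

lemma (in cring) func_space_induct:
  assumes v: "v \<in> carrier (func_space {..<n})"
    and zero: "Q \<zero>\<^bsub>func_space {..<n}\<^esub>"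
    and step: "\<And>w a j. \<lbrakk>w \<in> carrier (func_space {..<n}); Q w; a \<in> carrier R; j < n\<rbrakk>
      \<Longrightarrow> Q (w \<oplus>\<^bsub>func_space {..<n}\<^esub> a \<odot>\<^bsub>func_space {..<n}\<^esub> unit_vector n j)"
  shows "Q v"
proof -
  let ?F = "func_space {..<n}"
  define tr where "tr m = (\<lambda>i\<in>{..<n}. if i < m then v i else \<zero>)" for m
  have vi: "v i \<in> carrier R" if "i < n" for i
    using v that by (auto simp: func_space_def)
  have tr: "tr m \<in> carrier ?F" for m
    using vi by (auto simp: tr_def func_space_def)
  have Q: "Q (tr m)" if "m \<le> n" for m
    using that
  proof (induction m)
    case 0
    have "tr 0 = \<zero>\<^bsub>?F\<^esub>" by (simp add: tr_def func_space_def)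
    then show ?case using zero by simp
  next
    case (Suc m)
    have "tr (Suc m) = tr m \<oplus>\<^bsub>?F\<^esub> v m \<odot>\<^bsub>?F\<^esub> unit_vector n m"
      using Suc.prems vi
      by (auto simp: tr_def func_space_def unit_vector_def less_Suc_eq intro!: restrict_ext)
    moreover have "Q (tr m)" using Suc by simp
    ultimately show ?case
      using step[OF tr, of m "v m" m] vi Suc.prems by simp
  qed
  have "tr n = v"
    using v by (auto simp: tr_def func_space_def PiE_iff extensional_def)
  then show ?thesis using Q[of n] by simp
qed

lemma (in module) func_space_hom_eqI:
  assumes f: "f \<in> module_hom R (func_space {..<n}) M"
    and g: "g \<in> module_hom R (func_space {..<n}) M"
    and eq: "\<And>j. j < n \<Longrightarrow> f (unit_vector n j) = g (unit_vector n j)"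
    and v: "v \<in> carrier (func_space {..<n})"
  shows "f v = g v"
proof -
  interpret F: module R "func_space {..<n}" by (rule func_space_is_module)
  interpret f: mod_hom R "func_space {..<n}" M f
    by unfold_locales (rule f)
  interpret g: mod_hom R "func_space {..<n}" M g
    by unfold_locales (rule g)
  show ?thesis
    using v
    by (rule func_space_induct[where Q = "\<lambda>v. f v = g v"])
      (simp_all add: unit_vector_closed eq)
qed

lemma (in module) func_space_hom_in_submodule:
  assumes f: "f \<in> module_hom R (func_space {..<n}) M"
    and N: "submodule R N M"
    and gen: "\<And>j. j < n \<Longrightarrow> f (unit_vector n j) \<in> N"
    and v: "v \<in> carrier (func_space {..<n})"
  shows "f v \<in> N"
proof -
  interpret F: module R "func_space {..<n}" by (rule func_space_is_module)
  interpret f: mod_hom R "func_space {..<n}" M f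
    by unfold_locales (rule f)
  interpret N: submodule R N M by (rule N)
  show ?thesis
    using v
    by (rule func_space_induct[where Q = "\<lambda>v. f v \<in> N"])
      (simp_all add: unit_vector_closed gen)
qed

lemma (in cring) func_space_hom_exists:
  assumes c: "\<And>j. j < n \<Longrightarrow> c j \<in> T \<rightarrow> carrier R"
  shows "\<exists>g \<in> module_hom R (func_space {..<n}) (func_space T).
    \<forall>j<n. \<forall>t\<in>T. g (unit_vector n j) t = c j t"
proof
  let ?F = "func_space {..<n}" and ?T = "func_space T"
  let ?g = "\<lambda>v. \<lambda>t\<in>T. \<Oplus>j\<in>{..<n}. v j \<otimes> c j t"
  have c': "c j t \<in> carrier R" if "j < n" "t \<in> T" for j t
    using c that by blast
  have val: "v j \<in> carrier R" if "v \<in> carrier ?F" "j < n" for v j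
    using that by (auto simp: func_space_def)
  have closed: "?g v \<in> carrier ?T" if "v \<in> carrier ?F" for v
    using val[OF that] c' by (auto simp: func_space_def intro!: finsum_closed)
  have add: "?g (v \<oplus>\<^bsub>?F\<^esub> w) = ?g v \<oplus>\<^bsub>?T\<^esub> ?g w" if "v \<in> carrier ?F" "w \<in> carrier ?F" for v w
  proof -
    have "(\<Oplus>j\<in>{..<n}. (v \<oplus>\<^bsub>?F\<^esub> w) j \<otimes> c j t)
        = (\<Oplus>j\<in>{..<n}. v j \<otimes> c j t) \<oplus> (\<Oplus>j\<in>{..<n}. w j \<otimes> c j t)" if t: "t \<in> T" for t
    proof -
      have "(\<Oplus>j\<in>{..<n}. (v \<oplus>\<^bsub>?F\<^esub> w) j \<otimes> c j t)
          = (\<Oplus>j\<in>{..<n}. v j \<otimes> c j t \<oplus> w j \<otimes> c j t)"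
        using val that \<open>v \<in> _\<close> \<open>w \<in> _\<close> c'
        by (intro finsum_cong') (auto simp: func_space_def l_distr)
      then show ?thesis
        using val \<open>v \<in> _\<close> \<open>w \<in> _\<close> c' t by (simp add: finsum_addf)
    qed
    then show ?thesis by (auto simp: func_space_def)
  qed
  have smult: "?g (r \<odot>\<^bsub>?F\<^esub> v) = r \<odot>\<^bsub>?T\<^esub> ?g v" if "r \<in> carrier R" "v \<in> carrier ?F" for r v
  proof -
    have "(\<Oplus>j\<in>{..<n}. (r \<odot>\<^bsub>?F\<^esub> v) j \<otimes> c j t) = r \<otimes> (\<Oplus>j\<in>{..<n}. v j \<otimes> c j t)"
      if t: "t \<in> T" for t
    proof -
      have "(\<Oplus>j\<in>{..<n}. (r \<odot>\<^bsub>?F\<^esub> v) j \<otimes> c j t) = (\<Oplus>j\<in>{..<n}. r \<otimes> (v j \<otimes> c j t))"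
        using val t \<open>v \<in> _\<close> \<open>r \<in> _\<close> c'
        by (intro finsum_cong') (auto simp: func_space_def m_assoc)
      then show ?thesis
        using val \<open>v \<in> _\<close> \<open>r \<in> _\<close> c' t by (simp add: finsum_rdistr)
    qed
    then show ?thesis by (auto simp: func_space_def)
  qed
  show "?g \<in> module_hom R ?F ?T"
    using closed add smult by (auto simp: module_hom_def)
  show "\<forall>j<n. \<forall>t\<in>T. ?g (unit_vector n j) t = c j t"
  proof (intro allI impI ballI)
    fix j t assume j: "j < n" and t: "t \<in> T"
    have "(\<Oplus>i\<in>{..<n}. unit_vector n j i \<otimes> c i t) = (\<Oplus>i\<in>{..<n}. if j = i then c i t else \<zero>)"
      using c' t by (intro finsum_cong') (auto simp: unit_vector_def)
    also have "\<dots> = c j t"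
      using j t c' by (intro finsum_singleton) auto
    finally show "?g (unit_vector n j) t = c j t" using t by simp
  qed
qed

section \<open>Projective modules over a short local ring are free\<close>

text \<open>
  A surjection from a free module onto a projective module splits. If \<open>p \<circ> i = id\<close> exhibits \<open>M\<close> as
  a summand of \<open>A\<^sup>n\<close>, then \<open>p\<close> lifts along the surjection \<open>A\<^sup>S \<rightarrow> M\<close> given by the generators, and
  composing the lift with \<open>i\<close> gives the splitting.
\<close>

lemma (in module) projective_coordinates:
  assumes proj: "projective_module R M"
    and S: "finite S" "S \<subseteq> carrier M" "span S = carrier M"
  shows "\<exists>f \<in> module_hom R M (func_space S). \<forall>x\<in>carrier M. lincomb (f x) S = x"
proof -
  obtain n :: nat and i p where i: "i \<in> module_hom R M (func_space {..<n})"
    and p: "p \<in> module_hom R (func_space {..<n}) M"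
    and pi: "\<And>x. x \<in> carrier M \<Longrightarrow> p (i x) = x"
    using proj unfolding projective_module_def by blast
  let ?F = "func_space {..<n}"
  have "\<exists>c. c \<in> S \<rightarrow> carrier R \<and> lincomb c S = p (unit_vector n j)" for j
    using finite_in_span[OF S(1,2)] S(3) module_hom_closed[OF p] unit_vector_closed by blast
  then obtain c where c: "\<And>j. c j \<in> S \<rightarrow> carrier R"
    and lc: "\<And>j. lincomb (c j) S = p (unit_vector n j)"
    by metis
  obtain g where g: "g \<in> module_hom R ?F (func_space S)"
    and gc: "\<And>j t. j < n \<Longrightarrow> t \<in> S \<Longrightarrow> g (unit_vector n j) t = c j t"
    using func_space_hom_exists[of n c S] c by blast
  interpret L: mod_hom R "func_space S" M "\<lambda>a. lincomb a S"
    using S by (intro lincomb_is_mod_hom)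
  have Lg: "(\<lambda>v. lincomb (g v) S) \<in> module_hom R ?F M"
    using g L.f_hom unfolding module_hom_def by (auto simp: Pi_iff)
  have "lincomb (g v) S = p v" if "v \<in> carrier ?F" for v
  proof (rule func_space_hom_eqI[OF Lg p _ that])
    fix j assume "j < n"
    then show "lincomb (g (unit_vector n j)) S = p (unit_vector n j)"
      unfolding lc[symmetric] using gc c S by (intro lincomb_cong) auto
  qed
  then have "\<forall>x\<in>carrier M. lincomb (g (i x)) S = x"
    using pi module_hom_closed[OF i] by (auto simp: Pi_iff)
  moreover have "(\<lambda>x. g (i x)) \<in> module_hom R M (func_space S)"
    using g i unfolding module_hom_def by (auto simp: Pi_iff)
  ultimately show ?thesis by (intro bexI[of _ "\<lambda>x. g (i x)"])
qed

lemma (in module) projective_finitely_generated: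
  assumes "projective_module R M"
  shows "\<exists>S. finite S \<and> S \<subseteq> carrier M \<and> span S = carrier M"
proof -
  obtain n :: nat and i p where i: "i \<in> module_hom R M (func_space {..<n})"
    and p: "p \<in> module_hom R (func_space {..<n}) M"
    and pi: "\<And>x. x \<in> carrier M \<Longrightarrow> p (i x) = x"
    using assms unfolding projective_module_def by blast
  let ?S = "(\<lambda>j. p (unit_vector n j)) ` {..<n}"
  have S: "?S \<subseteq> carrier M"
  proof
    fix y assume "y \<in> ?S"
    then obtain j where "y = p (unit_vector n j)" by (rule imageE)
    then show "y \<in> carrier M"
      using funcset_mem[OF module_hom_closed[OF p] unit_vector_closed] by simp
  qed
  have "x \<in> span ?S" if "x \<in> carrier M" for x
  proof -
    have "p (i x) \<in> span ?S"
    proof (rule func_space_hom_in_submodule[OF p span_is_submodule[OF S]])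
      show "p (unit_vector n j) \<in> span ?S" if "j < n" for j
        using that by (intro subsetD[OF in_own_span[OF S]] imageI) simp
      show "i x \<in> carrier (func_space {..<n})"
        using that by (rule funcset_mem[OF module_hom_closed[OF i]])
    qed
    then show ?thesis using pi[OF that] by simp
  qed
  then have "span ?S = carrier M"
    using span_is_subset2[OF S] by blast
  moreover have "finite ?S" by simp
  ultimately show ?thesis
    using S by (intro exI[of _ ?S] conjI)
qed

lemma (in module) func_space_hom_lincomb:
  assumes f: "f \<in> module_hom R M (func_space T)" and t: "t \<in> T"
    and S: "finite S" "S \<subseteq> carrier M" and a: "a \<in> S \<rightarrow> carrier R"
  shows "f (lincomb a S) t = (\<Oplus>s\<in>S. a s \<otimes> f s t)"
proof -
  interpret F: module R "func_space T" by (rule func_space_is_module)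
  interpret f: mod_hom R M "func_space T" f
    by unfold_locales (rule f)
  have ft: "f x t \<in> carrier R" if "x \<in> carrier M" for x
    using f.f_im[OF that] t by (auto simp: func_space_def)
  show ?thesis
    using S a
  proof (induction S rule: finite_induct)
    case empty
    have "f \<zero>\<^bsub>M\<^esub> t = \<zero>" using t by (simp add: func_space_def)
    then show ?case by (simp add: lincomb_def)
  next
    case (insert s S)
    then have s: "s \<in> carrier M" "a s \<in> carrier R" and S: "S \<subseteq> carrier M" "a \<in> S \<rightarrow> carrier R"
      by auto
    have "lincomb a (insert s S) = a s \<odot>\<^bsub>M\<^esub> s \<oplus>\<^bsub>M\<^esub> lincomb a S"
      using lincomb_insert[of S a s] insert s S by simp
    then have "f (lincomb a (insert s S)) t = a s \<otimes> f s t \<oplus> f (lincomb a S) t"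
      using s S t by (simp add: func_space_def)
    also have "f (lincomb a S) t = (\<Oplus>s\<in>S. a s \<otimes> f s t)"
      using insert.IH S by simp
    also have "a s \<otimes> f s t \<oplus> \<dots> = (\<Oplus>s\<in>insert s S. a s \<otimes> f s t)"
    proof (rule R.finsum_insert[symmetric])
      show "(\<lambda>s. a s \<otimes> f s t) \<in> S \<rightarrow> carrier R"
        using S ft by blast
      show "a s \<otimes> f s t \<in> carrier R"
        using s ft by blast
    qed fact+
    finally show ?case .
  qed
qed


locale short_local_module = module R M + short_local_ring R for R and M (structure)

text \<open>A relation with a unit coefficient would make one generator redundant.\<close>

lemma (in short_local_module) minimal_generators_relation:
  assumes S: "finite S" "S \<subseteq> carrier M" "span S = carrier M"
    and min: "\<And>T. T \<subset> S \<Longrightarrow> span T \<noteq> carrier M"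
    and a: "a \<in> S \<rightarrow> carrier R" and rel: "lincomb a S = \<zero>\<^bsub>M\<^esub>" and s: "s \<in> S"
  shows "a s \<in> jacobson_radical R"
proof (rule ccontr)
  let ?T = "S - {s}"
  assume "a s \<notin> jacobson_radical R"
  then have u: "a s \<in> Units R" using unit_or_radical a s by blast
  have T: "?T \<subseteq> carrier M" using S by blast
  interpret N: submodule R "span ?T" M by (rule span_is_submodule[OF T])
  have aT: "lincomb a ?T \<in> span ?T"
    using a S(1) unfolding span_def by blast
  then have aT': "lincomb a ?T \<in> carrier M" using N.subset by blast
  have sM: "s \<in> carrier M" and as: "a s \<in> carrier R" and ias: "inv\<^bsub>R\<^esub> (a s) \<in> carrier R"
    using s S u by auto
  have "a s \<odot>\<^bsub>M\<^esub> s \<oplus>\<^bsub>M\<^esub> lincomb a ?T = \<zero>\<^bsub>M\<^esub>"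
    using lincomb_del2[OF S(1,2) a s] rel by simp
  then have "a s \<odot>\<^bsub>M\<^esub> s = \<ominus>\<^bsub>M\<^esub> lincomb a ?T"
    using sM as aT' by (simp add: M.minus_equality)
  then have as_s: "a s \<odot>\<^bsub>M\<^esub> s = (\<ominus>\<^bsub>R\<^esub> \<one>\<^bsub>R\<^esub>) \<odot>\<^bsub>M\<^esub> lincomb a ?T"
    using aT' by (simp add: smult_l_minus)
  have "s = inv\<^bsub>R\<^esub> (a s) \<odot>\<^bsub>M\<^esub> (a s \<odot>\<^bsub>M\<^esub> s)"
    using smult_assoc1[OF ias as sM] u sM by simp
  also have "\<dots> \<in> span ?T"
    unfolding as_s using aT ias by blast
  finally have sT: "s \<in> span ?T" .
  have "span S \<subseteq> span ?T"
    using in_own_span[OF T] sT by (intro span_is_subset span_is_submodule[OF T]) blast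
  then have "span ?T = carrier M"
    using S(3) span_is_subset2[OF T] by simp
  then show False using min[of ?T] s by blast
qed

text \<open>
  Express the generators themselves in terms of the linear coordinates \<open>f\<close>. Each
  \<open>s = \<Sum>t. f s t * t\<close> is also \<open>s = 1 * s\<close>, and by irredundancy the coefficients of the difference
  lie in \<open>J\<close>; that is, the matrix \<open>f s t\<close> is the identity modulo \<open>J\<close>. Applying the coordinates to a
  relation \<open>\<Sum>s. a s * s = 0\<close> gives \<open>\<Sum>s. a s * f s t = 0\<close>, so each \<open>a t\<close> is a combination of the
  \<open>a s\<close> with coefficients in \<open>J\<close>. The \<open>a s\<close> lie in \<open>J\<close> as well, by irredundancy, and
  \<open>J\<^sup>3 = 0\<close> forces them to vanish.
\<close>

lemma (in short_local_module) minimal_generators_basis: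
  assumes proj: "projective_module R M"
    and S: "finite S" "S \<subseteq> carrier M" "span S = carrier M"
    and min: "\<And>T. T \<subset> S \<Longrightarrow> span T \<noteq> carrier M"
  shows "finite_basis R M S"
proof -
  let ?J = "jacobson_radical R"
  interpret J: ideal ?J R by (rule radical_ideal)
  obtain f where f: "f \<in> module_hom R M (func_space S)"
    and coord: "\<And>x. x \<in> carrier M \<Longrightarrow> lincomb (f x) S = x"
    using projective_coordinates[OF proj S] by blast
  have fS: "f x t \<in> carrier R" if "x \<in> carrier M" "t \<in> S" for x t
    using module_hom_closed[OF f] that by (auto simp: func_space_def Pi_iff PiE_iff)
  interpret F: module R "func_space S" by (rule func_space_is_module)
  interpret f: mod_hom R M "func_space S" f
    by unfold_locales (rule f)
  let ?\<delta> = "\<lambda>s t. if s = t then \<one>\<^bsub>R\<^esub> else \<zero>\<^bsub>R\<^esub>"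
  have near_id: "f s t \<ominus>\<^bsub>R\<^esub> ?\<delta> s t \<in> ?J" if s: "s \<in> S" and t: "t \<in> S" for s t
  proof -
    have sM: "s \<in> carrier M" using s S by blast
    have "lincomb (?\<delta> s) S = ?\<delta> s s \<odot>\<^bsub>M\<^esub> s \<oplus>\<^bsub>M\<^esub> lincomb (?\<delta> s) (S - {s})"
      by (rule lincomb_del2[OF S(1,2) _ s]) simp
    also have "lincomb (?\<delta> s) (S - {s}) = \<zero>\<^bsub>M\<^esub>"
      unfolding lincomb_def using S by (intro finsum_all0) auto
    finally have d: "lincomb (?\<delta> s) S = s" using sM by simp
    have "lincomb (\<lambda>t. f s t \<ominus>\<^bsub>R\<^esub> ?\<delta> s t) S = lincomb (f s) S \<ominus>\<^bsub>M\<^esub> lincomb (?\<delta> s) S"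
      using fS sM by (intro lincomb_diff[OF S(1,2)]) auto
    also have "\<dots> = \<zero>\<^bsub>M\<^esub>"
      using d coord[OF sM] sM by simp
    finally show ?thesis
      using fS sM t by (intro minimal_generators_relation[OF S min]) auto
  qed
  have "\<not> lin_dep S"
  proof (rule finite_lin_indpt2[OF S(1,2)], intro ballI)
    fix a t assume a: "a \<in> S \<rightarrow> carrier R" and rel: "lincomb a S = \<zero>\<^bsub>M\<^esub>" and t: "t \<in> S"
    have aJ: "a s \<in> ?J" if "s \<in> S" for s
      using minimal_generators_relation[OF S min a rel that] .
    have aR: "a s \<in> carrier R" if "s \<in> S" for s
      using a that by blast
    have fixed: "(\<Oplus>\<^bsub>R\<^esub>s\<in>S. a s \<otimes>\<^bsub>R\<^esub> f s t) = \<zero>\<^bsub>R\<^esub>" if t: "t \<in> S" for t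
      using func_space_hom_lincomb[OF f t S(1,2) a] rel t by (simp add: func_space_def)
    \<comment> \<open>if \<open>z J\<close> kills all coefficients of the relation, then so does \<open>z\<close>; this is applied to
      \<open>z \<in> J\<close>, where the hypothesis is \<open>J\<^sup>3 = 0\<close>, and then to \<open>z = 1\<close>\<close>
    have step: "a t \<otimes>\<^bsub>R\<^esub> z = \<zero>\<^bsub>R\<^esub>"
      if z: "z \<in> carrier R" and zJ: "\<And>s y. s \<in> S \<Longrightarrow> y \<in> ?J \<Longrightarrow> a s \<otimes>\<^bsub>R\<^esub> z \<otimes>\<^bsub>R\<^esub> y = \<zero>\<^bsub>R\<^esub>"
        and t: "t \<in> S" for z t
    proof -
      have eq: "a s \<otimes>\<^bsub>R\<^esub> f s t \<otimes>\<^bsub>R\<^esub> z = (if t = s then a s \<otimes>\<^bsub>R\<^esub> z else \<zero>\<^bsub>R\<^esub>)" if s: "s \<in> S" for s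
      proof -
        have sR: "f s t \<in> carrier R" "a s \<in> carrier R" using fS S s t aR by auto
        have "\<zero>\<^bsub>R\<^esub> = a s \<otimes>\<^bsub>R\<^esub> z \<otimes>\<^bsub>R\<^esub> (f s t \<ominus>\<^bsub>R\<^esub> ?\<delta> s t)"
          using zJ[OF s near_id[OF s t]] by simp
        also have "\<dots> = a s \<otimes>\<^bsub>R\<^esub> f s t \<otimes>\<^bsub>R\<^esub> z \<ominus>\<^bsub>R\<^esub> a s \<otimes>\<^bsub>R\<^esub> z \<otimes>\<^bsub>R\<^esub> ?\<delta> s t"
          using sR z by (simp add: a_minus_def r_distr r_minus m_ac)
        finally have "a s \<otimes>\<^bsub>R\<^esub> f s t \<otimes>\<^bsub>R\<^esub> z \<ominus>\<^bsub>R\<^esub> a s \<otimes>\<^bsub>R\<^esub> z \<otimes>\<^bsub>R\<^esub> ?\<delta> s t = \<zero>\<^bsub>R\<^esub>" by (rule sym)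
        then have "a s \<otimes>\<^bsub>R\<^esub> f s t \<otimes>\<^bsub>R\<^esub> z = a s \<otimes>\<^bsub>R\<^esub> z \<otimes>\<^bsub>R\<^esub> ?\<delta> s t"
          using sR z by (subst (asm) R.r_right_minus_eq) auto
        then show ?thesis
          using sR z by (cases "t = s") auto
      qed
      have "\<zero>\<^bsub>R\<^esub> = (\<Oplus>\<^bsub>R\<^esub>s\<in>S. a s \<otimes>\<^bsub>R\<^esub> f s t) \<otimes>\<^bsub>R\<^esub> z"
        using fixed[OF t] z by simp
      also have "\<dots> = (\<Oplus>\<^bsub>R\<^esub>s\<in>S. a s \<otimes>\<^bsub>R\<^esub> f s t \<otimes>\<^bsub>R\<^esub> z)"
        using S fS aR t z by (intro finsum_ldistr) auto
      also have "\<dots> = (\<Oplus>\<^bsub>R\<^esub>s\<in>S. if t = s then a s \<otimes>\<^bsub>R\<^esub> z else \<zero>\<^bsub>R\<^esub>)"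
        using eq aR z by (intro R.finsum_cong') auto
      also have "\<dots> = a t \<otimes>\<^bsub>R\<^esub> z"
        using S(1) t aR z by (intro R.finsum_singleton) auto
      finally show ?thesis by simp
    qed
    have "a s \<otimes>\<^bsub>R\<^esub> z = \<zero>\<^bsub>R\<^esub>" if "s \<in> S" "z \<in> ?J" for s z
      using radical_cubed aJ that J.Icarr by (intro step) auto
    then have "a t \<otimes>\<^bsub>R\<^esub> \<one>\<^bsub>R\<^esub> = \<zero>\<^bsub>R\<^esub>"
      using t aR by (intro step) auto
    then show "a t = \<zero>\<^bsub>R\<^esub>" using aR t by simp
  qed
  then show ?thesis
    using S unfolding finite_basis_def by blast
qed

lemma (in short_local_module) generators_contain_basis:
  assumes proj: "projective_module R M"
    and S: "finite S" "S \<subseteq> carrier M" "span S = carrier M"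
  shows "\<exists>B\<subseteq>S. finite_basis R M B"
proof -
  define G where "G = {B. B \<subseteq> S \<and> span B = carrier M}"
  have "finite G" "S \<in> G"
    using S unfolding G_def by auto
  then obtain B where B: "B \<in> G" and min: "\<forall>T\<in>G. T \<subseteq> B \<longrightarrow> B = T"
    using finite_has_minimal2[of G S] by metis
  have BS: "B \<subseteq> S" "span B = carrier M"
    using B unfolding G_def by auto
  have "finite_basis R M B"
  proof (rule minimal_generators_basis[OF proj])
    show "finite B" using BS(1) S(1) by (rule finite_subset)
    show "B \<subseteq> carrier M" using BS S by blast
    show "span T \<noteq> carrier M" if "T \<subset> B" for T
      using that BS min unfolding G_def by blast
  qed fact
  then show ?thesis using BS by blast
qed

lemma (in short_local_module) module_rank_le:
  assumes "projective_module R M" "finite S" "S \<subseteq> carrier M" "span S = carrier M"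
  shows "module_rank R M \<le> card S"
proof -
  obtain B where "B \<subseteq> S" "finite_basis R M B"
    using generators_contain_basis[OF assms] by blast
  then have "module_rank R M \<le> card B"
    unfolding module_rank_def by (intro Least_le) blast
  also have "\<dots> \<le> card S"
    using \<open>B \<subseteq> S\<close> assms(2) by (intro card_mono)
  finally show ?thesis .
qed

lemma (in short_local_module) basis_of_rank:
  assumes "projective_module R M"
  shows "\<exists>B. finite_basis R M B \<and> card B = module_rank R M"
proof -
  obtain S where "finite S" "S \<subseteq> carrier M" "span S = carrier M"
    using projective_finitely_generated[OF assms] by (elim exE conjE)
  from generators_contain_basis[OF assms this] obtain B where "finite_basis R M B"
    by (elim exE conjE)
  then have "\<exists>n B. finite_basis R M B \<and> card B = n" by blast
  then show ?thesis unfolding module_rank_def by (rule LeastI_ex)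
qed


text \<open>
  From \<open>M = N + J M\<close> one gets \<open>J\<^sup>2 M \<subseteq> J\<^sup>2 N + J\<^sup>3 M \<subseteq> N\<close>, then \<open>J M \<subseteq> N\<close>, then \<open>M \<subseteq> N\<close>.
\<close>

lemma (in short_local_module) nakayama:
  assumes N: "submodule R N M"
    and cover: "\<And>x. x \<in> carrier M \<Longrightarrow>
      \<exists>n\<in>N. \<exists>r\<in>radical_submodule R M. x = n \<oplus>\<^bsub>M\<^esub> r"
  shows "N = carrier M"
proof
  let ?J = "jacobson_radical R"
  interpret J: ideal ?J R by (rule radical_ideal)
  interpret N: submodule R N M by (rule N)
  show "N \<subseteq> carrier M" by (rule N.subset)
  let ?JM = "{a \<odot>\<^bsub>M\<^esub> x | a x. a \<in> ?J \<and> x \<in> carrier M}"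
  \<comment> \<open>membership in \<open>N\<close> descends from \<open>z J M\<close> to \<open>z M\<close>\<close>
  have descend: "z \<odot>\<^bsub>M\<^esub> x \<in> N"
    if z: "z \<in> carrier R" and zJ: "\<And>a x. a \<in> ?J \<Longrightarrow> x \<in> carrier M \<Longrightarrow> (z \<otimes>\<^bsub>R\<^esub> a) \<odot>\<^bsub>M\<^esub> x \<in> N"
      and x: "x \<in> carrier M" for z x
  proof -
    let ?K = "{r \<in> carrier M. z \<odot>\<^bsub>M\<^esub> r \<in> N}"
    have "submodule R ?K M"
    proof (rule submodule.intro)
      show "module R M" by (rule module_axioms)
      show "?K \<subseteq> carrier M" by blast
      show "\<zero>\<^bsub>M\<^esub> \<in> ?K" using z by simp
      show "v \<oplus>\<^bsub>M\<^esub> w \<in> ?K" if "v \<in> ?K" "w \<in> ?K" for v w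
      proof -
        have "z \<odot>\<^bsub>M\<^esub> (v \<oplus>\<^bsub>M\<^esub> w) = z \<odot>\<^bsub>M\<^esub> v \<oplus>\<^bsub>M\<^esub> z \<odot>\<^bsub>M\<^esub> w"
          using that z by (intro smult_r_distr) auto
        then show ?thesis using that by simp
      qed
      show "c \<odot>\<^bsub>M\<^esub> v \<in> ?K" if "c \<in> carrier R" "v \<in> ?K" for c v
      proof -
        have v: "v \<in> carrier M" "z \<odot>\<^bsub>M\<^esub> v \<in> N" using that by auto
        have "z \<odot>\<^bsub>M\<^esub> (c \<odot>\<^bsub>M\<^esub> v) = c \<odot>\<^bsub>M\<^esub> (z \<odot>\<^bsub>M\<^esub> v)"
          using smult_assoc1[OF z that(1) v(1)] smult_assoc1[OF that(1) z v(1)]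
            R.m_comm[OF z that(1)] by simp
        then show ?thesis using that(1) v by simp
      qed
    qed
    moreover have "?JM \<subseteq> ?K"
      using zJ z smult_assoc1[OF z] J.Icarr by auto
    ultimately have K: "radical_submodule R M \<subseteq> ?K"
      unfolding radical_submodule_def by (intro span_is_subset)
    obtain n r where n: "n \<in> N" and r: "r \<in> radical_submodule R M" and xn: "x = n \<oplus>\<^bsub>M\<^esub> r"
      using cover[OF x] by blast
    have "z \<odot>\<^bsub>M\<^esub> x = z \<odot>\<^bsub>M\<^esub> n \<oplus>\<^bsub>M\<^esub> z \<odot>\<^bsub>M\<^esub> r"
      unfolding xn using z subsetD[OF N.subset n] subsetD[OF K r] by (intro smult_r_distr) simp_all
    also have "\<dots> \<in> N"
      using N.smult_closed[OF z n] subsetD[OF K r] by (intro N.m_closed) simp_all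
    finally show ?thesis .
  qed
  have 3: "(a \<otimes>\<^bsub>R\<^esub> b) \<odot>\<^bsub>M\<^esub> x \<in> N" if "a \<in> ?J" "b \<in> ?J" "x \<in> carrier M" for a b x
  proof (rule descend[OF _ _ that(3)])
    show "a \<otimes>\<^bsub>R\<^esub> b \<in> carrier R" using that J.Icarr by simp
    show "(a \<otimes>\<^bsub>R\<^esub> b \<otimes>\<^bsub>R\<^esub> c) \<odot>\<^bsub>M\<^esub> y \<in> N" if c: "c \<in> ?J" "y \<in> carrier M" for c y
      using radical_cubed[OF \<open>a \<in> ?J\<close> \<open>b \<in> ?J\<close> c(1)] c(2) by simp
  qed
  have 2: "a \<odot>\<^bsub>M\<^esub> x \<in> N" if "a \<in> ?J" "x \<in> carrier M" for a x
    using J.Icarr[OF that(1)] 3[OF that(1)] that(2) by (rule descend)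
  show "carrier M \<subseteq> N"
  proof
    fix x assume x: "x \<in> carrier M"
    have "\<one>\<^bsub>R\<^esub> \<odot>\<^bsub>M\<^esub> x \<in> N"
      by (rule descend) (use x 2 J.Icarr in simp_all)
    then show "x \<in> N" using x by simp
  qed
qed

text \<open>
  If the images of \<open>S\<close> generate \<open>d M\<close> and \<open>d\<close> is minimal in the sense that its kernel lies in
  \<open>J M\<close>, then \<open>M\<close> is the sum of the span of \<open>S\<close> and \<open>J M\<close>, and Nakayama's lemma applies.
\<close>

lemma (in short_local_module) module_rank_le_of_hom:
  assumes proj: "projective_module R M"
    and Q: "module R Q" and d: "d \<in> module_hom R M Q"
    and ker: "\<And>x. x \<in> carrier M \<Longrightarrow> d x = \<zero>\<^bsub>Q\<^esub> \<Longrightarrow> x \<in> radical_submodule R M"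
    and S: "finite S" "S \<subseteq> carrier M"
    and surj: "\<And>x. x \<in> carrier M \<Longrightarrow> \<exists>y\<in>span S. d x = d y"
  shows "module_rank R M \<le> card S"
proof (rule module_rank_le[OF proj S nakayama[OF span_is_submodule[OF S(2)]]])
  interpret Q: module R Q by (rule Q)
  interpret d: mod_hom R M Q d
    by unfold_locales (rule d)
  fix x assume x: "x \<in> carrier M"
  then obtain y where y: "y \<in> span S" "d x = d y" using surj by blast
  have yM: "y \<in> carrier M" using y(1) span_is_subset2[OF S(2)] by blast
  have "d (x \<ominus>\<^bsub>M\<^esub> y) = d y \<ominus>\<^bsub>Q\<^esub> d y"
    using x yM y(2) by simp
  also have "\<dots> = \<zero>\<^bsub>Q\<^esub>"
    using d.f_im[OF yM] by (simp add: a_minus_def Q.M.r_neg)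
  finally have "x \<ominus>\<^bsub>M\<^esub> y \<in> radical_submodule R M"
    using x yM by (intro ker) auto
  moreover have "x = y \<oplus>\<^bsub>M\<^esub> (x \<ominus>\<^bsub>M\<^esub> y)"
    using x yM by (simp add: a_minus_def M.a_lcomm M.r_neg)
  ultimately show "\<exists>n\<in>span S. \<exists>r\<in>radical_submodule R M. x = n \<oplus>\<^bsub>M\<^esub> r"
    using y(1) by blast
qed

section \<open>Modules of rank at most one\<close>

definition free_generator :: "('a, 'm) ring_scheme \<Rightarrow> ('a, 'p, 'n) module_scheme \<Rightarrow> 'p \<Rightarrow> bool" where
  "free_generator R M e \<longleftrightarrow> e \<in> carrier M \<and>
     (\<forall>x\<in>carrier M. \<exists>a\<in>carrier R. x = a \<odot>\<^bsub>M\<^esub> e) \<and>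
     (\<forall>a\<in>carrier R. a \<odot>\<^bsub>M\<^esub> e = \<zero>\<^bsub>M\<^esub> \<longrightarrow> a = \<zero>\<^bsub>R\<^esub>)"

lemma (in module) span_empty: "span {} = {\<zero>\<^bsub>M\<^esub>}"
  by (auto simp: span_def lincomb_def)

lemma (in module) smult_in_span_singleton:
  assumes "e \<in> carrier M" "a \<in> carrier R"
  shows "a \<odot>\<^bsub>M\<^esub> e \<in> span {e}"
proof -
  interpret N: submodule R "span {e}" M
    using assms by (intro span_is_submodule) simp
  show ?thesis
    using assms in_own_span[of "{e}"] by (intro N.smult_closed) auto
qed

lemma (in short_local_module) rank_zero:
  assumes "projective_module R M" "module_rank R M = 0"
  shows "carrier M = {\<zero>\<^bsub>M\<^esub>}"
proof -
  obtain B where "finite_basis R M B" "card B = 0"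
    using basis_of_rank[OF assms(1)] assms(2) by auto
  then have "span {} = carrier M"
    by (auto simp: finite_basis_def)
  then show ?thesis using span_empty by simp
qed

lemma (in short_local_module) rank_one_free_generator:
  assumes "projective_module R M" "module_rank R M = 1"
  shows "\<exists>e. free_generator R M e"
proof -
  obtain B where B: "finite_basis R M B" "card B = 1"
    using basis_of_rank[OF assms(1)] assms(2) by auto
  then obtain e where e: "B = {e}" by (auto simp: card_1_singleton_iff)
  have eM: "e \<in> carrier M" and gen: "span {e} = carrier M" and ind: "\<not> lin_dep {e}"
    using B(1) unfolding e finite_basis_def by auto
  have lc: "lincomb a {e} = a e \<odot>\<^bsub>M\<^esub> e" if "a e \<in> carrier R" for a
    using that eM by (simp add: lincomb_def)
  have "\<exists>a\<in>carrier R. x = a \<odot>\<^bsub>M\<^esub> e" if x: "x \<in> carrier M" for x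
  proof -
    have "\<exists>a. a \<in> {e} \<rightarrow> carrier R \<and> lincomb a {e} = x"
      using x eM gen by (intro finite_in_span) auto
    then obtain a where "a \<in> {e} \<rightarrow> carrier R" "lincomb a {e} = x" by blast
    then show ?thesis using lc[of a] by (intro bexI[of _ "a e"]) auto
  qed
  moreover have "a = \<zero>\<^bsub>R\<^esub>" if a: "a \<in> carrier R" "a \<odot>\<^bsub>M\<^esub> e = \<zero>\<^bsub>M\<^esub>" for a
  proof (rule ccontr)
    assume "a \<noteq> \<zero>\<^bsub>R\<^esub>"
    then have "lin_dep {e}"
      using a lc[of "\<lambda>_. a"] by (intro lin_dep_crit[of "{e}" _ "\<lambda>_. a" e]) auto
    then show False using ind by simp
  qed
  ultimately show ?thesis
    using eM unfolding free_generator_def by blast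
qed

lemma free_generator_cancel:
  assumes "module R M" and e: "free_generator R M e" and a: "a \<in> carrier R" and b: "b \<in> carrier R"
    and eq: "a \<odot>\<^bsub>M\<^esub> e = b \<odot>\<^bsub>M\<^esub> e"
  shows "a = b"
proof -
  interpret module R M by fact
  have eM: "e \<in> carrier M" using e by (simp add: free_generator_def)
  have "(a \<ominus>\<^bsub>R\<^esub> b) \<odot>\<^bsub>M\<^esub> e = a \<odot>\<^bsub>M\<^esub> e \<ominus>\<^bsub>M\<^esub> b \<odot>\<^bsub>M\<^esub> e"
    using a b eM by (simp add: a_minus_def smult_l_distr smult_l_minus)
  also have "\<dots> = \<zero>\<^bsub>M\<^esub>"
    using b eM by (simp add: eq a_minus_def M.r_neg)
  finally have "a \<ominus>\<^bsub>R\<^esub> b = \<zero>\<^bsub>R\<^esub>"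
    using e a b unfolding free_generator_def by auto
  then show ?thesis using a b by (simp add: R.r_right_minus_eq)
qed

lemma free_generator_hom:
  assumes M: "module R M" and N: "module R N"
    and e: "free_generator R M e" and y: "y \<in> carrier N"
  shows "\<exists>f\<in>module_hom R M N. \<forall>a\<in>carrier R. f (a \<odot>\<^bsub>M\<^esub> e) = a \<odot>\<^bsub>N\<^esub> y"
proof -
  interpret M: module R M by (rule M)
  interpret N: module R N by (rule N)
  have eM: "e \<in> carrier M" using e by (simp add: free_generator_def)
  have "\<exists>a. \<forall>x\<in>carrier M. a x \<in> carrier R \<and> x = a x \<odot>\<^bsub>M\<^esub> e"
    using e unfolding free_generator_def by (intro bchoice) blast
  then obtain a where aR: "\<And>x. x \<in> carrier M \<Longrightarrow> a x \<in> carrier R"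
    and ax: "\<And>x. x \<in> carrier M \<Longrightarrow> a x \<odot>\<^bsub>M\<^esub> e = x"
    by metis
  have val: "a (c \<odot>\<^bsub>M\<^esub> e) = c" if "c \<in> carrier R" for c
    using that eM aR ax by (intro free_generator_cancel[OF M e]) auto
  have "(\<lambda>x. a x \<odot>\<^bsub>N\<^esub> y) \<in> module_hom R M N"
    unfolding module_hom_def
  proof (intro CollectI conjI allI impI)
    show "(\<lambda>x. a x \<odot>\<^bsub>N\<^esub> y) \<in> carrier M \<rightarrow> carrier N"
      using aR y by auto
  next
    fix u v assume uv: "u \<in> carrier M \<and> v \<in> carrier M"
    have "u \<oplus>\<^bsub>M\<^esub> v = (a u \<oplus>\<^bsub>R\<^esub> a v) \<odot>\<^bsub>M\<^esub> e"
      using uv aR ax eM by (simp add: M.smult_l_distr)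
    then have "a (u \<oplus>\<^bsub>M\<^esub> v) = a u \<oplus>\<^bsub>R\<^esub> a v"
      using val[of "a u \<oplus>\<^bsub>R\<^esub> a v"] uv aR by simp
    then show "a (u \<oplus>\<^bsub>M\<^esub> v) \<odot>\<^bsub>N\<^esub> y = a u \<odot>\<^bsub>N\<^esub> y \<oplus>\<^bsub>N\<^esub> a v \<odot>\<^bsub>N\<^esub> y"
      using uv aR y by (simp add: N.smult_l_distr)
  next
    fix r v assume rv: "r \<in> carrier R \<and> v \<in> carrier M"
    have "r \<odot>\<^bsub>M\<^esub> v = (r \<otimes>\<^bsub>R\<^esub> a v) \<odot>\<^bsub>M\<^esub> e"
      using rv aR ax eM by (simp add: M.smult_assoc1)
    then have "a (r \<odot>\<^bsub>M\<^esub> v) = r \<otimes>\<^bsub>R\<^esub> a v"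
      using val[of "r \<otimes>\<^bsub>R\<^esub> a v"] rv aR by simp
    then show "a (r \<odot>\<^bsub>M\<^esub> v) \<odot>\<^bsub>N\<^esub> y = r \<odot>\<^bsub>N\<^esub> (a v \<odot>\<^bsub>N\<^esub> y)"
      using rv aR y by (simp add: N.smult_assoc1)
  qed
  then show ?thesis
    using val by (intro bexI[of _ "\<lambda>x. a x \<odot>\<^bsub>N\<^esub> y"]) auto
qed

lemma free_generator_unit_multiple:
  assumes "module R M" and e: "free_generator R M e" and c: "c \<in> Units R"
  shows "free_generator R M (c \<odot>\<^bsub>M\<^esub> e)"
proof -
  interpret module R M by fact
  have eM: "e \<in> carrier M" using e by (simp add: free_generator_def)
  have cR: "c \<in> carrier R" and ic: "inv\<^bsub>R\<^esub> c \<in> carrier R"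
    using c by auto
  have "\<exists>b\<in>carrier R. x = b \<odot>\<^bsub>M\<^esub> (c \<odot>\<^bsub>M\<^esub> e)" if x: "x \<in> carrier M" for x
  proof -
    obtain a where a: "a \<in> carrier R" "x = a \<odot>\<^bsub>M\<^esub> e"
      using e x unfolding free_generator_def by blast
    have "(a \<otimes>\<^bsub>R\<^esub> inv\<^bsub>R\<^esub> c) \<odot>\<^bsub>M\<^esub> (c \<odot>\<^bsub>M\<^esub> e) = (a \<otimes>\<^bsub>R\<^esub> inv\<^bsub>R\<^esub> c \<otimes>\<^bsub>R\<^esub> c) \<odot>\<^bsub>M\<^esub> e"
      using a ic cR eM by (simp add: smult_assoc1)
    also have "\<dots> = x"
      using a c ic cR by (simp add: R.m_assoc)
    finally show ?thesis using a ic by (intro bexI[of _ "a \<otimes>\<^bsub>R\<^esub> inv\<^bsub>R\<^esub> c"]) auto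
  qed
  moreover have "a = \<zero>\<^bsub>R\<^esub>" if a: "a \<in> carrier R" "a \<odot>\<^bsub>M\<^esub> (c \<odot>\<^bsub>M\<^esub> e) = \<zero>\<^bsub>M\<^esub>" for a
  proof -
    have "(a \<otimes>\<^bsub>R\<^esub> c) \<odot>\<^bsub>M\<^esub> e = \<zero>\<^bsub>M\<^esub>"
      using a cR eM by (simp add: smult_assoc1)
    then have "a \<otimes>\<^bsub>R\<^esub> c = \<zero>\<^bsub>R\<^esub>"
      using e a cR unfolding free_generator_def by auto
    moreover have "a = a \<otimes>\<^bsub>R\<^esub> c \<otimes>\<^bsub>R\<^esub> inv\<^bsub>R\<^esub> c"
      using a c cR ic by (simp add: R.m_assoc)
    ultimately show ?thesis using ic by simp
  qed
  ultimately show ?thesis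
    using eM cR unfolding free_generator_def by auto
qed

lemma free_generator_hom_bij:
  assumes M: "module R M" and N: "module R N"
    and e: "free_generator R M e" and y: "free_generator R N y"
    and f: "\<And>a. a \<in> carrier R \<Longrightarrow> f (a \<odot>\<^bsub>M\<^esub> e) = a \<odot>\<^bsub>N\<^esub> y"
  shows "bij_betw f (carrier M) (carrier N)"
  unfolding bij_betw_def
proof
  interpret M: module R M by (rule M)
  interpret N: module R N by (rule N)
  have eM: "e \<in> carrier M" and yN: "y \<in> carrier N"
    using e y by (simp_all add: free_generator_def)
  show "inj_on f (carrier M)"
  proof (rule inj_onI)
    fix u v assume uv: "u \<in> carrier M" "v \<in> carrier M" "f u = f v"
    obtain a b where ab: "a \<in> carrier R" "u = a \<odot>\<^bsub>M\<^esub> e" "b \<in> carrier R" "v = b \<odot>\<^bsub>M\<^esub> e"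
      using e uv(1,2) unfolding free_generator_def by blast
    then have "a \<odot>\<^bsub>N\<^esub> y = b \<odot>\<^bsub>N\<^esub> y" using uv(3) f by simp
    then have "a = b" using ab by (intro free_generator_cancel[OF N y])
    then show "u = v" using ab by simp
  qed
  show "f ` carrier M = carrier N"
  proof
    show "f ` carrier M \<subseteq> carrier N"
    proof (intro image_subsetI)
      fix x assume "x \<in> carrier M"
      then obtain a where "a \<in> carrier R" "x = a \<odot>\<^bsub>M\<^esub> e"
        using e unfolding free_generator_def by blast
      then show "f x \<in> carrier N" using f yN by simp
    qed
    show "carrier N \<subseteq> f ` carrier M"
    proof
      fix z assume "z \<in> carrier N"
      then obtain a where a: "a \<in> carrier R" "z = a \<odot>\<^bsub>N\<^esub> y"
        using y unfolding free_generator_def by blast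
      then have "z = f (a \<odot>\<^bsub>M\<^esub> e)" using f by simp
      then show "z \<in> f ` carrier M" using a eM by (intro image_eqI[of _ _ "a \<odot>\<^bsub>M\<^esub> e"]) simp_all
    qed
  qed
qed

section \<open>Complexes with terms of rank one\<close>

lemma exact_projective_complexD:
  assumes "exact_projective_complex R P d"
  shows "projective_module R (P i)" "module R (P i)" "d i \<in> module_hom R (P i) (P (i - 1))"
  using assms unfolding exact_projective_complex_def projective_module_def by blast+

lemma exact_at:
  assumes ex: "exact_projective_complex R P d" and x: "x \<in> carrier (P i)"
  shows "d i x = \<zero>\<^bsub>P (i - 1)\<^esub> \<longleftrightarrow> x \<in> d (i + 1) ` carrier (P (i + 1))"
proof -
  note D = exact_projective_complexD[OF ex]
  have hom: "mod_hom R (P i) (P (i - 1)) (d i)" for i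
    by (intro mod_hom.intro mod_hom_axioms.intro D)
  have hom': "mod_hom R (P (i + 1)) (P i) (d (i + 1))"
    using hom[of "i + 1"] by simp
  have idx: "i + 1 - 1 = i" "i + 1 - 2 = i - 1" by simp_all
  have "mod_hom.im (P (i + 1)) (d (i + 1)) = mod_hom.ker (P i) (P (i - 1)) (d i)"
    using ex unfolding exact_projective_complex_def by (metis idx)
  then show ?thesis
    using x unfolding mod_hom.im_def[OF hom'] mod_hom.ker_def[OF hom] by auto
qed

text \<open>
  On a set \<open>I\<close> of indices with terms of rank one the complex consists of multiplications by ring
  elements. The two uses are \<open>I = UNIV\<close> for type I and \<open>I = {..v}\<close> for type II.
\<close>

lemma (in short_local_ring) rank_one_complex:
  assumes ex: "exact_projective_complex R P d"
    and rank: "\<And>i. i \<in> I \<Longrightarrow> module_rank R (P i) = 1"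
  obtains e w where "\<And>i. i \<in> I \<Longrightarrow> free_generator R (P i) (e i)"
    and "\<And>i. i \<in> I \<Longrightarrow> i - 1 \<in> I \<Longrightarrow> w i \<in> carrier R"
    and "\<And>i. i \<in> I \<Longrightarrow> i - 1 \<in> I \<Longrightarrow> d i (e i) = w i \<odot>\<^bsub>P (i - 1)\<^esub> e (i - 1)"
    and "\<And>i. i - 1 \<in> I \<Longrightarrow> i \<in> I \<Longrightarrow> i + 1 \<in> I \<Longrightarrow> annihilator R (w i) = PIdl (w (i + 1))"
proof -
  note D = exact_projective_complexD[OF ex]
  have "\<exists>x. free_generator R (P i) x" if "i \<in> I" for i
  proof -
    interpret short_local_module R "P i"
      by (intro short_local_module.intro D short_local_ring_axioms)
    show ?thesis
      using rank_one_free_generator[OF D(1) rank[OF that]] .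
  qed
  then obtain e where e: "\<And>i. i \<in> I \<Longrightarrow> free_generator R (P i) (e i)"
    by metis
  have eP: "e i \<in> carrier (P i)" if "i \<in> I" for i
    using e[OF that] by (simp add: free_generator_def)
  have "\<exists>a. a \<in> carrier R \<and> d i (e i) = a \<odot>\<^bsub>P (i - 1)\<^esub> e (i - 1)" if "i \<in> I" "i - 1 \<in> I" for i
    using funcset_mem[OF module_hom_closed[OF D(3)] eP[OF that(1)]] e[OF that(2)]
    unfolding free_generator_def by blast
  then obtain w where w: "\<And>i. i \<in> I \<Longrightarrow> i - 1 \<in> I \<Longrightarrow> w i \<in> carrier R"
    and dw: "\<And>i. i \<in> I \<Longrightarrow> i - 1 \<in> I \<Longrightarrow> d i (e i) = w i \<odot>\<^bsub>P (i - 1)\<^esub> e (i - 1)"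
    by metis
  have "annihilator R (w i) = PIdl (w (i + 1))"
    if I: "i - 1 \<in> I" "i \<in> I" "i + 1 \<in> I" for i
  proof -
    interpret P0: module R "P (i - 1)" by (rule D)
    interpret P1: module R "P i" by (rule D)
    interpret P2: module R "P (i + 1)" by (rule D)
    have wR: "w i \<in> carrier R" "w (i + 1) \<in> carrier R"
      using w[of i] w[of "i + 1"] I by simp_all
    have d1: "d i (a \<odot>\<^bsub>P i\<^esub> e i) = (a \<otimes> w i) \<odot>\<^bsub>P (i - 1)\<^esub> e (i - 1)" if "a \<in> carrier R" for a
      using module_hom_smult[OF D(3) that eP[OF I(2)]] dw[OF I(2,1)] wR that eP[OF I(1)]
      by (simp add: P0.smult_assoc1)
    have d2: "d (i + 1) (b \<odot>\<^bsub>P (i + 1)\<^esub> e (i + 1)) = (b \<otimes> w (i + 1)) \<odot>\<^bsub>P i\<^esub> e i"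
      if "b \<in> carrier R" for b
      using module_hom_smult[OF D(3) that eP[OF I(3)]] dw[of "i + 1"] I wR that eP[OF I(2)]
      by (simp add: P1.smult_assoc1)
    have "a \<otimes> w i = \<zero> \<longleftrightarrow> (\<exists>b\<in>carrier R. a = b \<otimes> w (i + 1))" if a: "a \<in> carrier R" for a
    proof -
      have ae: "a \<odot>\<^bsub>P i\<^esub> e i \<in> carrier (P i)"
        using a eP[OF I(2)] by simp
      have "a \<otimes> w i = \<zero> \<longleftrightarrow> (a \<otimes> w i) \<odot>\<^bsub>P (i - 1)\<^esub> e (i - 1) = \<zero>\<^bsub>P (i - 1)\<^esub>"
        using e[OF I(1)] a wR eP[OF I(1)] unfolding free_generator_def by auto
      also have "\<dots> \<longleftrightarrow> (\<exists>y\<in>carrier (P (i + 1)). a \<odot>\<^bsub>P i\<^esub> e i = d (i + 1) y)"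
        using exact_at[OF ex ae] d1[OF a] by auto
      also have "\<dots> \<longleftrightarrow> (\<exists>b\<in>carrier R. a \<odot>\<^bsub>P i\<^esub> e i = d (i + 1) (b \<odot>\<^bsub>P (i + 1)\<^esub> e (i + 1)))"
        using e[OF I(3)] P2.smult_closed unfolding free_generator_def by metis
      also have "\<dots> \<longleftrightarrow> (\<exists>b\<in>carrier R. a = b \<otimes> w (i + 1))"
        using d2 free_generator_cancel[OF D(2) e[OF I(2)] a] wR by (metis m_closed)
      finally show ?thesis .
    qed
    then show ?thesis
      using wR unfolding annihilator_def cgenideal_def by auto
  qed
  with e w dw show ?thesis by (rule that)
qed

lemma (in short_local_ring) rank_one_complex_periodic:
  assumes ex: "exact_projective_complex R P d"
    and rank: "\<And>i. module_rank R (P i) = 1"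
  shows "periodic_2 R P d"
proof -
  note D = exact_projective_complexD[OF ex]
  obtain e w where e: "\<And>i. free_generator R (P i) (e i)"
    and w: "\<And>i. w i \<in> carrier R"
    and dw: "\<And>i. d i (e i) = w i \<odot>\<^bsub>P (i - 1)\<^esub> e (i - 1)"
    and ann: "\<And>i. annihilator R (w i) = PIdl (w (i + 1))"
    using rank_one_complex[OF ex, of UNIV] rank by auto
  have eP: "e i \<in> carrier (P i)" for i
    using e by (simp add: free_generator_def)
  have "PIdl (w i) = PIdl (w (i + 2))" for i
  proof -
    have idx: "i - 1 + 1 = i" "i + 1 + 1 = i + 2" by simp_all
    have "annihilator R (w (i - 1)) = PIdl (w i)" "annihilator R (w i) = PIdl (w (i + 1))"
      "annihilator R (w (i + 1)) = PIdl (w (i + 2))"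
      using ann[of "i - 1"] ann[of i] ann[of "i + 1"] unfolding idx by simp_all
    then show ?thesis
      using annihilator_two_step[of "w (i - 1)" "w i" "w (i + 1)"] w by simp
  qed
  then have "\<exists>u\<in>Units R. w (i + 2) = u \<otimes> w i" for i
    using same_ideal_unit_multiple w by blast
  then obtain u where u: "\<And>i. u i \<in> Units R" and wu: "\<And>i. w (i + 2) = u i \<otimes> w i"
    by metis
  obtain c where "\<forall>i. c i \<in> Units R \<and> c (i - 1) = c i \<otimes> u i"
    using unit_thread[of u, OF u] by (elim exE)
  then have c: "\<And>i. c i \<in> Units R" and cu: "\<And>i. c (i - 1) = c i \<otimes> u i"
    by simp_all
  have cR: "c i \<in> carrier R" and uR: "u i \<in> carrier R" for i
    using c u by (simp_all add: Units_closed)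
  let ?y = "\<lambda>i. c i \<odot>\<^bsub>P (i + 2)\<^esub> e (i + 2)"
  have y: "free_generator R (P (i + 2)) (?y i)" for i
    by (intro free_generator_unit_multiple D e c)
  then have yP: "?y i \<in> carrier (P (i + 2))" for i
    by (simp add: free_generator_def)
  have "\<exists>f\<in>module_hom R (P i) (P (i + 2)). \<forall>a\<in>carrier R. f (a \<odot>\<^bsub>P i\<^esub> e i) = a \<odot>\<^bsub>P (i + 2)\<^esub> ?y i" for i
    by (intro free_generator_hom D e yP)
  then obtain \<phi> where \<phi>: "\<And>i. \<phi> i \<in> module_hom R (P i) (P (i + 2))"
    and \<phi>e: "\<And>i a. a \<in> carrier R \<Longrightarrow> \<phi> i (a \<odot>\<^bsub>P i\<^esub> e i) = a \<odot>\<^bsub>P (i + 2)\<^esub> ?y i"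
    by metis
  have bij: "bij_betw (\<phi> i) (carrier (P i)) (carrier (P (i + 2)))" for i
    by (rule free_generator_hom_bij[OF D(2) D(2) e y \<phi>e])
  have comm: "\<phi> (i - 1) (d i x) = d (i + 2) (\<phi> i x)" if x: "x \<in> carrier (P i)" for i x
  proof -
    interpret P0: module R "P (i - 1)" by (rule D)
    interpret P1: module R "P (i + 1)" by (rule D)
    interpret P2: module R "P (i + 2)" by (rule D)
    have idx: "i + 2 - 1 = i + 1" by simp
    obtain a where a: "a \<in> carrier R" "x = a \<odot>\<^bsub>P i\<^esub> e i"
      using e x unfolding free_generator_def by blast
    have "d i x = (a \<otimes> w i) \<odot>\<^bsub>P (i - 1)\<^esub> e (i - 1)"
      using module_hom_smult[OF D(3) a(1) eP] dw a w eP by (simp add: P0.smult_assoc1)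
    then have "\<phi> (i - 1) (d i x) = (a \<otimes> w i) \<odot>\<^bsub>P (i + 1)\<^esub> (c (i - 1) \<odot>\<^bsub>P (i + 1)\<^esub> e (i + 1))"
      using \<phi>e[of "a \<otimes> w i" "i - 1"] a w by (simp add: add.commute[of _ i])
    also have "\<dots> = (a \<otimes> w i \<otimes> (c i \<otimes> u i)) \<odot>\<^bsub>P (i + 1)\<^esub> e (i + 1)"
      using a w cR uR eP by (simp add: cu P1.smult_assoc1)
    also have "a \<otimes> w i \<otimes> (c i \<otimes> u i) = a \<otimes> c i \<otimes> (u i \<otimes> w i)"
      using a(1) w[of i] cR[of i] uR[of i] by (simp add: m_ac)
    also have "\<dots> \<odot>\<^bsub>P (i + 1)\<^esub> e (i + 1) = (a \<otimes> c i) \<odot>\<^bsub>P (i + 1)\<^esub> (w (i + 2) \<odot>\<^bsub>P (i + 1)\<^esub> e (i + 1))"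
      using a w cR uR eP by (simp add: wu P1.smult_assoc1)
    also have "\<dots> = (a \<otimes> c i) \<odot>\<^bsub>P (i + 1)\<^esub> d (i + 2) (e (i + 2))"
      using dw[of "i + 2"] unfolding idx by simp
    also have "\<dots> = d (i + 2) ((a \<otimes> c i) \<odot>\<^bsub>P (i + 2)\<^esub> e (i + 2))"
      using module_hom_smult[OF D(3)[of "i + 2"] _ eP, of "a \<otimes> c i"] a cR unfolding idx by simp
    also have "(a \<otimes> c i) \<odot>\<^bsub>P (i + 2)\<^esub> e (i + 2) = \<phi> i x"
      using a cR eP \<phi>e[OF a(1)] by (simp add: P2.smult_assoc1)
    finally show ?thesis .
  qed
  show ?thesis
    unfolding periodic_2_def using \<phi> bij comm by (intro exI[of _ \<phi>]) simp
qed

text \<open>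
  Minimality of the next differential, together with exactness, puts the kernel of \<open>d (i + 1)\<close> into
  \<open>J P (i + 1)\<close>. So the rank of \<open>P (i + 1)\<close> is bounded by the number of generators of the image.
\<close>

lemma (in short_local_ring) minimal_complex_rank_le:
  assumes ex: "exact_projective_complex R P d" and min: "minimal_complex R P d"
    and S: "finite S" "S \<subseteq> carrier (P (i + 1))"
    and surj: "\<And>x. x \<in> carrier (P (i + 1)) \<Longrightarrow> \<exists>y\<in>module.span R (P (i + 1)) S. d (i + 1) x = d (i + 1) y"
  shows "module_rank R (P (i + 1)) \<le> card S"
proof -
  note D = exact_projective_complexD[OF ex]
  interpret short_local_module R "P (i + 1)"
    by (intro short_local_module.intro D short_local_ring_axioms)
  have d: "d (i + 1) \<in> module_hom R (P (i + 1)) (P i)"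
    using D(3)[of "i + 1"] by simp
  have idx: "i + 2 - 1 = i + 1" "i + 1 - 1 = i" "i + 1 + 1 = i + 2" by simp_all
  have "mod_hom R (P (i + 2)) (P (i + 1)) (d (i + 2))"
    using D(3)[of "i + 2"] unfolding idx by (intro mod_hom.intro mod_hom_axioms.intro D)
  then have im: "d (i + 2) ` carrier (P (i + 2)) \<subseteq> radical_submodule R (P (i + 1))"
    using spec[OF min[unfolded minimal_complex_def], of "i + 2"] unfolding idx by (simp add: mod_hom.im_def)
  show ?thesis
  proof (rule module_rank_le_of_hom[OF D(1) D(2) d _ S surj])
    fix x assume "x \<in> carrier (P (i + 1))" "d (i + 1) x = \<zero>\<^bsub>P i\<^esub>"
    then have "x \<in> d (i + 2) ` carrier (P (i + 2))"
      using exact_at[OF ex, of x "i + 1"] unfolding idx by simp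
    then show "x \<in> radical_submodule R (P (i + 1))" using im by blast
  qed
qed

lemma (in short_local_ring) no_growth_from_rank_zero:
  assumes ex: "exact_projective_complex R P d" and min: "minimal_complex R P d"
    and rank: "module_rank R (P i) = 0"
  shows "module_rank R (P (i + 1)) = 0"
proof -
  note D = exact_projective_complexD[OF ex]
  interpret P0: short_local_module R "P i"
    by (intro short_local_module.intro D short_local_ring_axioms)
  interpret P1: module R "P (i + 1)" by (rule D)
  have zero: "carrier (P i) = {\<zero>\<^bsub>P i\<^esub>}"
    by (rule P0.rank_zero[OF D(1) rank])
  have "d (i + 1) x = \<zero>\<^bsub>P i\<^esub>" if "x \<in> carrier (P (i + 1))" for x
    using funcset_mem[OF module_hom_closed[OF D(3)] that] zero by simp
  then show ?thesis
    using minimal_complex_rank_le[OF ex min, of "{}" i] P1.span_empty by simp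
qed

text \<open>
  The kernel of \<open>d v\<close> corresponds to \<open>ann (w v)\<close>. Exactness at \<open>P v\<close> only identifies it with the
  image of \<open>P (v + 1)\<close>, whose rank is not known; but exactness at the two preceding places
  identifies it with the principal ideal \<open>(w (v - 1))\<close>.
\<close>

lemma (in short_local_ring) no_growth_from_rank_one:
  assumes ex: "exact_projective_complex R P d" and min: "minimal_complex R P d"
    and rank: "\<And>i. i \<le> v \<Longrightarrow> module_rank R (P i) = 1"
  shows "module_rank R (P (v + 1)) \<le> 1"
proof -
  note D = exact_projective_complexD[OF ex]
  obtain e w where e: "\<And>i. i \<le> v \<Longrightarrow> free_generator R (P i) (e i)"
    and w: "\<And>i. i \<le> v \<Longrightarrow> w i \<in> carrier R"
    and dw: "\<And>i. i \<le> v \<Longrightarrow> d i (e i) = w i \<odot>\<^bsub>P (i - 1)\<^esub> e (i - 1)"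
    and ann: "\<And>i. i + 1 \<le> v \<Longrightarrow> annihilator R (w i) = PIdl (w (i + 1))"
    using rank_one_complex[OF ex, of "{..v}"] rank by auto
  have eP: "e i \<in> carrier (P i)" if "i \<le> v" for i
    using e[OF that] by (simp add: free_generator_def)
  interpret P0: module R "P (v - 1)" by (rule D)
  interpret P1: module R "P v" by (rule D)
  interpret P2: module R "P (v + 1)" by (rule D)
  let ?w = "w (v - 1)"
  have wR: "w (v - 2) \<in> carrier R" "?w \<in> carrier R" "w v \<in> carrier R"
    by (simp_all add: w)
  have annv: "annihilator R (w v) = PIdl ?w"
    using annihilator_two_step[of "w (v - 2)" ?w "w v"] ann[of "v - 2"] ann[of "v - 1"] wR by simp
  have ker: "d v (a \<odot>\<^bsub>P v\<^esub> e v) = \<zero>\<^bsub>P (v - 1)\<^esub> \<longleftrightarrow> a \<in> PIdl ?w" if a: "a \<in> carrier R" for a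
  proof -
    have "d v (a \<odot>\<^bsub>P v\<^esub> e v) = (a \<otimes> w v) \<odot>\<^bsub>P (v - 1)\<^esub> e (v - 1)"
      using module_hom_smult[OF D(3) a eP[of v]] dw[of v] wR a eP[of "v - 1"]
      by (simp add: P0.smult_assoc1)
    then have "d v (a \<odot>\<^bsub>P v\<^esub> e v) = \<zero>\<^bsub>P (v - 1)\<^esub> \<longleftrightarrow> a \<otimes> w v = \<zero>"
      using e[of "v - 1"] a wR eP[of "v - 1"] unfolding free_generator_def by auto
    then show ?thesis using a unfolding annv[symmetric] by (simp add: annihilator_def)
  qed
  have ev: "e v \<in> carrier (P v)" by (simp add: eP)
  have "?w \<odot>\<^bsub>P v\<^esub> e v \<in> d (v + 1) ` carrier (P (v + 1))"
    using exact_at[OF ex, of "?w \<odot>\<^bsub>P v\<^esub> e v" v] ker[of ?w] wR cgenideal_self ev by simp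
  then obtain s where s: "s \<in> carrier (P (v + 1))" and ds: "d (v + 1) s = ?w \<odot>\<^bsub>P v\<^esub> e v"
    by (metis imageE)
  have "module_rank R (P (v + 1)) \<le> card {s}"
  proof (rule minimal_complex_rank_le[OF ex min])
    fix x assume x: "x \<in> carrier (P (v + 1))"
    have dx: "d (v + 1) x \<in> carrier (P v)"
      using funcset_mem[OF module_hom_closed[OF D(3)] x] by simp
    obtain a where a: "a \<in> carrier R" "d (v + 1) x = a \<odot>\<^bsub>P v\<^esub> e v"
      using e[of v] dx unfolding free_generator_def by auto
    have "d v (d (v + 1) x) = \<zero>\<^bsub>P (v - 1)\<^esub>"
      using exact_at[OF ex dx] x by blast
    then obtain b where b: "b \<in> carrier R" "a = b \<otimes> ?w"
      using ker[OF a(1)] a(2) by (auto simp: cgenideal_def)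
    have "d (v + 1) x = b \<odot>\<^bsub>P v\<^esub> d (v + 1) s"
      using a b wR ev by (simp add: ds P1.smult_assoc1)
    also have "\<dots> = d (v + 1) (b \<odot>\<^bsub>P (v + 1)\<^esub> s)"
      using module_hom_smult[OF D(3)[of "v + 1"] b(1) s] by simp
    finally show "\<exists>y\<in>P2.span {s}. d (v + 1) x = d (v + 1) y"
      using P2.smult_in_span_singleton[OF s b(1)] by blast
  qed (use s in auto)
  then show ?thesis by simp
qed

lemma (in short_local_ring) no_type_II_with_rank_one:
  assumes II: "complex_type_II R P d" and one: "module_rank R (P i) = 1"
  shows False
proof -
  let ?t = "\<lambda>i. module_rank R (P i)"
  have ex: "exact_projective_complex R P d" and min: "minimal_complex R P d"
    using II by (simp_all add: complex_type_II_def)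
  obtain v where up: "\<And>j. j \<ge> v \<Longrightarrow> ?t (j + 1) > ?t j" and const: "\<And>j. j \<le> v \<Longrightarrow> ?t j = ?t v"
    using II unfolding complex_type_II_def by blast
  have mono: "?t v \<le> ?t (v + int n)" for n
  proof (induction n)
    case (Suc n)
    have "?t (v + int n) < ?t (v + int n + 1)" by (rule up) simp
    then show ?case using Suc by (simp add: algebra_simps)
  qed simp
  have "?t v \<le> 1"
  proof (cases "i \<le> v")
    case True
    then show ?thesis using const one by (metis order_refl)
  next
    case False
    then show ?thesis using mono[of "nat (i - v)"] one by simp
  qed
  then consider "?t v = 0" | "?t v = 1" by linarith
  then show False
  proof cases
    case 1
    show False
      using no_growth_from_rank_zero[OF ex min 1] up[OF order_refl] by simp
  next
    case 2
    have "?t (v + 1) \<le> 1"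
      by (rule no_growth_from_rank_one[OF ex min]) (simp add: const 2)
    then show False using up[OF order_refl] 2 by simp
  qed
qed

theorem corollary10p5:
  fixes k :: "'k ring" and A :: "('k, 'a) module"
  assumes "fd_local_algebra k A" and "short A"
  shows "(\<forall>(P :: int \<Rightarrow> ('a, 'p) module) d.
            complex_type_I A P d \<and> (\<exists>i. module_rank A (P i) = 1) \<longrightarrow> periodic_2 A P d) \<and>
         \<not> (\<exists>(P :: int \<Rightarrow> ('a, 'p) module) d.
            complex_type_II A P d \<and> (\<exists>i. module_rank A (P i) = 1))"
proof -
  interpret short_local_ring A
    using assms by (rule fd_short_local_ring)
  have "periodic_2 A P d"
    if I: "complex_type_I A P d" and one: "module_rank A (P i) = 1"
    for P :: "int \<Rightarrow> ('a, 'p) module" and d i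
  proof (rule rank_one_complex_periodic)
    show "exact_projective_complex A P d" using I by (simp add: complex_type_I_def)
    show "module_rank A (P j) = 1" for j
      using I one unfolding complex_type_I_def by metis
  qed
  then show ?thesis using no_type_II_with_rank_one by blast
qed

end
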